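(* Let $p=(p_{ijk})_{i,j,k\in\{0,1\}}\in\Delta_7$ be strictly positive (all eight entries $>0$). Then $p\in\operatorname{RBM}_{3,2}$ if and only if $p$ lies in the union of the following six sets: $$\{p_{000}p_{011}\ge p_{001}p_{010},\ p_{100}p_{111}\ge p_{101}p_{110}\},\qquad \{p_{000}p_{011}\le p_{001}p_{010},\ p_{100}p_{111}\le p_{101}p_{110}\},$$ $$\{p_{000}p_{101}\ge p_{001}p_{100},\ p_{010}p_{111}\ge p_{011}p_{110}\},\qquad \{p_{000}p_{101}\le p_{001}p_{100},\ p_{010}p_{111}\le p_{011}p_{110}\},$$ $$\{p_{000}p_{110}\ge p_{100}p_{010},\ p_{001}p_{111}\ge p_{101}p_{011}\},\qquad \{p_{000}p_{110}\le p_{100}p_{010},\ p_{001}p_{111}\le p_{101}p_{011}\}.$$ Equivalently, with the determinants $d_{i,j}$ defined in the context, $p\in\operatorname{RBM}_{3,2}$ iff there is $i\in\{1,2,3\}$ with $d_{i,0}(p)\,d_{i,1}(p)\ge 0$.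
   Context: A distribution of three binary random variables is a $2\times2\times2$ tensor $p=(p_{ijk})_{i,j,k\in\{0,1\}}$ with nonnegative entries summing to $1$; the set of these is the simplex $\Delta_7$. For nonnegative vectors $a,b,c\in\mathbb{R}^2_{\ge0}$, $a\otimes b\otimes c$ is the tensor with entries $a_ib_jc_k$. The model $\operatorname{RBM}_{3,2}$ is the set of $p\in\Delta_7$ of the form $p=(a_1\otimes b_1\otimes c_1+d_1\otimes e_1\otimes f_1)*(a_2\otimes b_2\otimes c_2+d_2\otimes e_2\otimes f_2)$ with all vectors in $\mathbb{R}^2_{\ge0}$, where $*$ is the entrywise (Hadamard) product. The determinants of the six $2\times2$ slices are $d_{1,0}=p_{000}p_{011}-p_{001}p_{010}$, $d_{1,1}=p_{100}p_{111}-p_{101}p_{110}$, $d_{2,0}=p_{000}p_{101}-p_{001}p_{100}$, $d_{2,1}=p_{010}p_{111}-p_{011}p_{110}$, $d_{3,0}=p_{000}p_{110}-p_{010}p_{100}$, $d_{3,1}=p_{001}p_{111}-p_{011}p_{101}$. *)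

theory Defs
  imports Main "HOL.Real"
begin

(* Index convention: binary index 0 is False, 1 is True.
   A 2x2x2 tensor is a function bool => bool => bool => real,
   a vector in R^2 is a function bool => real. *)

type_synonym tensor3 = "bool \<Rightarrow> bool \<Rightarrow> bool \<Rightarrow> real"
type_synonym vec2 = "bool \<Rightarrow> real"

definition simplex7 :: "tensor3 set" where
  "simplex7 = {p. (\<forall>i j k. p i j k \<ge> 0) \<and> (\<Sum>i\<in>UNIV. \<Sum>j\<in>UNIV. \<Sum>k\<in>UNIV. p i j k) = 1}"

definition nonneg_vec :: "vec2 \<Rightarrow> bool" where
  "nonneg_vec a \<longleftrightarrow> (\<forall>i. a i \<ge> 0)"

definition outer3 :: "vec2 \<Rightarrow> vec2 \<Rightarrow> vec2 \<Rightarrow> tensor3" where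
  "outer3 a b c = (\<lambda>i j k. a i * b j * c k)"

definition hadamard :: "tensor3 \<Rightarrow> tensor3 \<Rightarrow> tensor3" where
  "hadamard p q = (\<lambda>i j k. p i j k * q i j k)"

definition RBM32 :: "tensor3 set" where
  "RBM32 = {p \<in> simplex7. \<exists>a1 b1 c1 d1 e1 f1 a2 b2 c2 d2 e2 f2.
     (\<forall>v\<in>{a1, b1, c1, d1, e1, f1, a2, b2, c2, d2, e2, f2}. nonneg_vec v) \<and>
     p = hadamard (\<lambda>i j k. outer3 a1 b1 c1 i j k + outer3 d1 e1 f1 i j k)
                  (\<lambda>i j k. outer3 a2 b2 c2 i j k + outer3 d2 e2 f2 i j k)}"

end

(* Necessity: the slices of a x b x c + d x e x f across the three axes have determinants
   whose signs are those of BC, AC and AB, where A, B, C are the determinants of the pairs (a, d),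
   (b, e), (c, f).  Two sign patterns of this kind always agree on some axis, and on that axis
   the determinant inequalities are preserved by the Hadamard product.

   Sufficiency: if both slices p_0, p_1 have nonnegative determinant, multiply the positive rank one
   matrix that agrees with p_i off the entry (1,1), for i = 0, 1, by the tensor that is 1 except at
   the entries (i,1,1), where it is at least 1.  Both tensors are mixtures.  The other five
   conditions follow by permuting the axes and flipping the last index. *)

theory Submission
  imports Defs
begin

text \<open>These are the tensors of nonnegative rank at most two: unnormalized mixtures of two
  product distributions.\<close>

definition mixture2 :: "tensor3 \<Rightarrow> bool" where
  "mixture2 q \<longleftrightarrow> (\<exists>a b c d e f. (\<forall>v\<in>{a, b, c, d, e, f}. nonneg_vec v) \<and>
     q = (\<lambda>i j k. outer3 a b c i j k + outer3 d e f i j k))"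

definition mixture_product :: "tensor3 \<Rightarrow> bool" where
  "mixture_product p \<longleftrightarrow> (\<exists>q r. mixture2 q \<and> mixture2 r \<and> p = hadamard q r)"

text \<open>Only the first axis is treated. The other two are reached by permuting arguments, as in
  \<open>\<lambda>j i k. q i j k\<close> and \<open>\<lambda>k i j. q i j k\<close>.\<close>

definition slices_ge :: "tensor3 \<Rightarrow> bool" where
  "slices_ge q \<longleftrightarrow> (\<forall>i. q i False False * q i True True \<ge> q i False True * q i True False)"

definition slices_le :: "tensor3 \<Rightarrow> bool" where
  "slices_le q \<longleftrightarrow> (\<forall>i. q i False False * q i True True \<le> q i False True * q i True False)"

lemma mixture2I:
  assumes "nonneg_vec a" "nonneg_vec b" "nonneg_vec c" "nonneg_vec d" "nonneg_vec e" "nonneg_vec f"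
    and "\<And>i j k. q i j k = a i * b j * c k + d i * e j * f k"
  shows "mixture2 q"
  unfolding mixture2_def outer3_def using assms
  by (intro exI[of _ a] exI[of _ b] exI[of _ c] exI[of _ d] exI[of _ e] exI[of _ f])
    (auto simp: fun_eq_iff)

lemma mixture2E:
  assumes "mixture2 q"
  obtains a b c d e f where "nonneg_vec a" "nonneg_vec b" "nonneg_vec c"
    "nonneg_vec d" "nonneg_vec e" "nonneg_vec f"
    "q = (\<lambda>i j k. a i * b j * c k + d i * e j * f k)"
  using assms unfolding mixture2_def outer3_def by auto

lemma RBM32_iff: "p \<in> RBM32 \<longleftrightarrow> p \<in> simplex7 \<and> mixture_product p"
proof
  assume "p \<in> RBM32"
  then obtain a1 b1 c1 d1 e1 f1 a2 b2 c2 d2 e2 f2 where "p \<in> simplex7"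
    and "\<forall>v\<in>{a1, b1, c1, d1, e1, f1, a2, b2, c2, d2, e2, f2}. nonneg_vec v"
    and "p = hadamard (\<lambda>i j k. outer3 a1 b1 c1 i j k + outer3 d1 e1 f1 i j k)
                      (\<lambda>i j k. outer3 a2 b2 c2 i j k + outer3 d2 e2 f2 i j k)"
    unfolding RBM32_def by blast
  moreover from this(2) have "mixture2 (\<lambda>i j k. outer3 a1 b1 c1 i j k + outer3 d1 e1 f1 i j k)"
    and "mixture2 (\<lambda>i j k. outer3 a2 b2 c2 i j k + outer3 d2 e2 f2 i j k)"
    by (auto simp: outer3_def intro: mixture2I[of a1 b1 c1 d1 e1 f1] mixture2I[of a2 b2 c2 d2 e2 f2])
  ultimately show "p \<in> simplex7 \<and> mixture_product p"
    unfolding mixture_product_def by blast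
next
  assume *: "p \<in> simplex7 \<and> mixture_product p"
  then obtain q r where "mixture2 q" "mixture2 r" and p: "p = hadamard q r"
    unfolding mixture_product_def by blast
  from \<open>mixture2 q\<close> obtain a1 b1 c1 d1 e1 f1
    where 1: "\<forall>v\<in>{a1, b1, c1, d1, e1, f1}. nonneg_vec v"
      and q: "q = (\<lambda>i j k. outer3 a1 b1 c1 i j k + outer3 d1 e1 f1 i j k)"
    unfolding mixture2_def by blast
  from \<open>mixture2 r\<close> obtain a2 b2 c2 d2 e2 f2
    where 2: "\<forall>v\<in>{a2, b2, c2, d2, e2, f2}. nonneg_vec v"
      and r: "r = (\<lambda>i j k. outer3 a2 b2 c2 i j k + outer3 d2 e2 f2 i j k)"
    unfolding mixture2_def by blast
  have "\<forall>v\<in>{a1, b1, c1, d1, e1, f1, a2, b2, c2, d2, e2, f2}. nonneg_vec v"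
    using 1 2 by simp
  with * p q r show "p \<in> RBM32"
    unfolding RBM32_def by blast
qed

lemma mixture2_swap12:
  assumes "mixture2 q"
  shows "mixture2 (\<lambda>i j k. q j i k)"
proof -
  from assms obtain a b c d e f where nn: "nonneg_vec a" "nonneg_vec b" "nonneg_vec c"
    "nonneg_vec d" "nonneg_vec e" "nonneg_vec f"
    and q: "q = (\<lambda>i j k. a i * b j * c k + d i * e j * f k)"
    by (rule mixture2E)
  show ?thesis
    by (rule mixture2I[of b a c e d f]) (use nn q in \<open>auto simp: mult_ac\<close>)
qed

lemma mixture2_swap23:
  assumes "mixture2 q"
  shows "mixture2 (\<lambda>i j k. q i k j)"
proof -
  from assms obtain a b c d e f where nn: "nonneg_vec a" "nonneg_vec b" "nonneg_vec c"
    "nonneg_vec d" "nonneg_vec e" "nonneg_vec f"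
    and q: "q = (\<lambda>i j k. a i * b j * c k + d i * e j * f k)"
    by (rule mixture2E)
  show ?thesis
    by (rule mixture2I[of a c b d f e]) (use nn q in \<open>auto simp: mult_ac\<close>)
qed

text \<open>The flip exchanges the columns of each slice and so negates its determinant. This
  reduces \<open>slices_le\<close> to \<open>slices_ge\<close>.\<close>

lemma mixture2_flip3:
  assumes "mixture2 q"
  shows "mixture2 (\<lambda>i j k. q i j (\<not> k))"
proof -
  from assms obtain a b c d e f where nn: "nonneg_vec a" "nonneg_vec b" "nonneg_vec c"
    "nonneg_vec d" "nonneg_vec e" "nonneg_vec f"
    and q: "q = (\<lambda>i j k. a i * b j * c k + d i * e j * f k)"
    by (rule mixture2E)
  show ?thesis
    by (rule mixture2I[of a b "\<lambda>k. c (\<not> k)" d e "\<lambda>k. f (\<not> k)"])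
      (use nn q in \<open>auto simp: nonneg_vec_def\<close>)
qed

lemma mixture2_nonneg: "mixture2 q \<Longrightarrow> q i j k \<ge> 0"
  by (elim mixture2E) (auto simp: nonneg_vec_def)

lemma mixture_product_swap12: "mixture_product p \<Longrightarrow> mixture_product (\<lambda>i j k. p j i k)"
  unfolding mixture_product_def hadamard_def using mixture2_swap12 by blast

lemma mixture_product_swap23: "mixture_product p \<Longrightarrow> mixture_product (\<lambda>i j k. p i k j)"
  unfolding mixture_product_def hadamard_def using mixture2_swap23 by blast

lemma mixture_product_flip3: "mixture_product p \<Longrightarrow> mixture_product (\<lambda>i j k. p i j (\<not> k))"
  unfolding mixture_product_def hadamard_def using mixture2_flip3 by blast

text \<open>Slice \<open>i\<close> factors as [b e] diag(a_i, d_i) [c f]^T, so its determinant is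
  a_i d_i det[b e] det[c f]. Since a_i d_i is nonnegative, both slices follow the sign of the
  product of the last two determinants.\<close>

lemma mixture_slices:
  assumes "nonneg_vec a" "nonneg_vec d"
    and q: "\<And>i j k. q i j k = a i * b j * c k + d i * e j * f k"
  shows "0 \<le> (b False * e True - b True * e False) * (c False * f True - c True * f False)
      \<Longrightarrow> slices_ge q"
    and "(b False * e True - b True * e False) * (c False * f True - c True * f False) \<le> 0
      \<Longrightarrow> slices_le q"
proof -
  let ?BC = "(b False * e True - b True * e False) * (c False * f True - c True * f False)"
  have det: "q i False False * q i True True - q i False True * q i True False = (a i * d i) * ?BC" for i
    by (simp add: q algebra_simps)
  have ad: "0 \<le> a i * d i" for i
    using assms(1,2) by (simp add: nonneg_vec_def)
  show "slices_ge q" if "0 \<le> ?BC"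
    unfolding slices_ge_def using det mult_nonneg_nonneg[OF ad that] by (metis diff_ge_0_iff_ge)
  show "slices_le q" if "?BC \<le> 0"
    unfolding slices_le_def using det mult_nonneg_nonpos[OF ad that] by (metis diff_le_0_iff_le)
qed

text \<open>The Booleans record which of the three pair determinants are nonnegative. Equal Booleans
  give a nonnegative product and different ones a nonpositive product, also when a determinant
  vanishes.\<close>

lemma mixture2_slice_signs:
  assumes "mixture2 q"
  shows "\<exists>x y z :: bool. (if y = z then slices_ge q else slices_le q) \<and>
    (if x = z then slices_ge (\<lambda>j i k. q i j k) else slices_le (\<lambda>j i k. q i j k)) \<and>
    (if x = y then slices_ge (\<lambda>k i j. q i j k) else slices_le (\<lambda>k i j. q i j k))"
proof -
  from assms obtain a b c d e f where nn: "nonneg_vec a" "nonneg_vec b" "nonneg_vec c"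
    "nonneg_vec d" "nonneg_vec e" "nonneg_vec f"
    and q: "q = (\<lambda>i j k. a i * b j * c k + d i * e j * f k)"
    by (rule mixture2E)
  define A where "A = a False * d True - a True * d False"
  define B where "B = b False * e True - b True * e False"
  define C where "C = c False * f True - c True * f False"
  note S1 = mixture_slices[of a d q b c e f, folded B_def C_def]
  note S2 = mixture_slices[of b e "\<lambda>j i k. q i j k" a c d f, folded A_def C_def]
  note S3 = mixture_slices[of c f "\<lambda>k i j. q i j k" a b d e, folded A_def B_def]
  have 1: "if (B \<ge> 0) = (C \<ge> 0) then slices_ge q else slices_le q"
    using S1 nn q by (auto simp: zero_le_mult_iff mult_le_0_iff)
  have 2: "if (A \<ge> 0) = (C \<ge> 0) then slices_ge (\<lambda>j i k. q i j k) else slices_le (\<lambda>j i k. q i j k)"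
    using S2 nn q by (auto simp: zero_le_mult_iff mult_le_0_iff mult_ac)
  have 3: "if (A \<ge> 0) = (B \<ge> 0) then slices_ge (\<lambda>k i j. q i j k) else slices_le (\<lambda>k i j. q i j k)"
    using S3 nn q by (auto simp: zero_le_mult_iff mult_le_0_iff mult_ac)
  from 1 2 3 show ?thesis by (intro exI[of _ "A \<ge> 0"] exI[of _ "B \<ge> 0"] exI[of _ "C \<ge> 0"] conjI)
qed

text \<open>Two inequalities between nonnegative products are multiplied, and the factors are
  regrouped as in the slices of a Hadamard product. Exchanging diagonal and antidiagonal serves both
  directions.\<close>

lemma mult_cross_mono:
  fixes x y z w x' y' z' w' :: real
  assumes "x * y \<le> z * w" "x' * y' \<le> z' * w'" "0 \<le> x'" "0 \<le> y'" "0 \<le> z" "0 \<le> w"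
  shows "(x * x') * (y * y') \<le> (z * z') * (w * w')"
  using mult_mono[OF assms(1,2)] assms(3-6) by (simp add: mult_ac)

lemma slices_ge_hadamard:
  assumes "slices_ge q" "slices_ge r" "\<And>i j k. q i j k \<ge> 0" "\<And>i j k. r i j k \<ge> 0"
  shows "slices_ge (\<lambda>i j k. q i j k * r i j k)"
  using assms unfolding slices_ge_def by (blast intro: mult_cross_mono)

lemma slices_le_hadamard:
  assumes "slices_le q" "slices_le r" "\<And>i j k. q i j k \<ge> 0" "\<And>i j k. r i j k \<ge> 0"
  shows "slices_le (\<lambda>i j k. q i j k * r i j k)"
  using assms unfolding slices_le_def by (blast intro: mult_cross_mono)

text \<open>Count each of \<open>y = z\<close>, \<open>x = z\<close>, \<open>x = y\<close> as +1 if
  true and -1 if false: the three signs multiply to +1. Two patterns opposite on all three axes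
  would have opposite products, so the patterns of the two factors agree on some axis.\<close>

lemma mixture_product_slices:
  assumes "mixture_product p"
  shows "slices_ge p \<or> slices_le p \<or>
    slices_ge (\<lambda>j i k. p i j k) \<or> slices_le (\<lambda>j i k. p i j k) \<or>
    slices_ge (\<lambda>k i j. p i j k) \<or> slices_le (\<lambda>k i j. p i j k)"
proof -
  from assms obtain q r where q: "mixture2 q" and r: "mixture2 r" and p: "p = (\<lambda>i j k. q i j k * r i j k)"
    unfolding mixture_product_def hadamard_def by blast
  note nn = mixture2_nonneg[OF q] mixture2_nonneg[OF r]
  note hadamard_slices = slices_ge_hadamard[of q r, OF _ _ nn]
    slices_ge_hadamard[of "\<lambda>j i k. q i j k" "\<lambda>j i k. r i j k", OF _ _ nn]
    slices_ge_hadamard[of "\<lambda>k i j. q i j k" "\<lambda>k i j. r i j k", OF _ _ nn]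
    slices_le_hadamard[of q r, OF _ _ nn]
    slices_le_hadamard[of "\<lambda>j i k. q i j k" "\<lambda>j i k. r i j k", OF _ _ nn]
    slices_le_hadamard[of "\<lambda>k i j. q i j k" "\<lambda>k i j. r i j k", OF _ _ nn]
  from mixture2_slice_signs[OF q] obtain x y z :: bool where
    "if y = z then slices_ge q else slices_le q"
    "if x = z then slices_ge (\<lambda>j i k. q i j k) else slices_le (\<lambda>j i k. q i j k)"
    "if x = y then slices_ge (\<lambda>k i j. q i j k) else slices_le (\<lambda>k i j. q i j k)"
    by blast
  moreover from mixture2_slice_signs[OF r] obtain x' y' z' :: bool where
    "if y' = z' then slices_ge r else slices_le r"
    "if x' = z' then slices_ge (\<lambda>j i k. r i j k) else slices_le (\<lambda>j i k. r i j k)"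
    "if x' = y' then slices_ge (\<lambda>k i j. r i j k) else slices_le (\<lambda>k i j. r i j k)"
    by blast
  ultimately show ?thesis
    unfolding p using hadamard_slices
    by (cases x; cases y; cases z; cases x'; cases y'; cases z') simp_all
qed

lemma mixture_product_if_slices_ge:
  assumes pos: "\<And>i j k. p i j k > 0" and ge: "slices_ge p"
  shows "mixture_product p"
proof -
  \<comment> \<open>The number 1 + \<open>s i\<close> is the odds ratio of slice \<open>i\<close>,
    which \<open>slices_ge\<close> makes at least 1.\<close>
  define s where "s i = p i False False * p i True True / (p i False True * p i True False) - 1" for i
  \<comment> \<open>The first column of slice \<open>i\<close>, times its first row divided by the
    corner entry, is the rank one matrix that agrees with the slice off the entry (True,
    True).\<close>
  define b where "b i j = p i j False" for i j
  define c where "c i k = p i False k / p i False False" for i k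
  define q :: tensor3 where "q = (\<lambda>i j k. 1 + s i * of_bool j * of_bool k)"
  define r :: tensor3 where "r = (\<lambda>i j k. b i j * c i k)"
  have "0 \<le> s i" for i
    using ge pos[of i] by (simp add: s_def slices_ge_def)
  then have "mixture2 q"
    by (intro mixture2I[of "\<lambda>_. 1" "\<lambda>_. 1" "\<lambda>_. 1" s of_bool of_bool]) (auto simp: nonneg_vec_def q_def)
  moreover have "0 \<le> b i j" "0 \<le> c i j" for i j
    using pos by (simp_all add: b_def c_def less_imp_le)
  \<comment> \<open>The first index itself selects the mixture component: the indicator vectors
    leave exactly one summand in each slice, so the two rank one slices can be chosen
    independently.\<close>
  then have "mixture2 r"
    by (intro mixture2I[of "\<lambda>i. of_bool (\<not> i)" "b False" "c False" of_bool "b True" "c True"])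
      (auto simp: nonneg_vec_def r_def)
  moreover have "p i j k = q i j k * r i j k" for i j k
    using pos[of i, THEN less_imp_neq]
    by (cases j; cases k) (auto simp: q_def r_def s_def b_def c_def field_simps)
  ultimately show ?thesis
    unfolding mixture_product_def hadamard_def by blast
qed

lemma mixture_product_if_slices_le:
  assumes "\<And>i j k. p i j k > 0" "slices_le p"
  shows "mixture_product p"
proof -
  have "slices_ge (\<lambda>i j k. p i j (\<not> k))"
    using assms(2) by (simp add: slices_ge_def slices_le_def)
  then show ?thesis
    using mixture_product_flip3[OF mixture_product_if_slices_ge] assms(1) by fastforce
qed

lemma mixture_product_iff_slices:
  assumes "\<And>i j k. p i j k > 0"
  shows "mixture_product p \<longleftrightarrow> slices_ge p \<or> slices_le p \<or>
    slices_ge (\<lambda>j i k. p i j k) \<or> slices_le (\<lambda>j i k. p i j k) \<or>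
    slices_ge (\<lambda>k i j. p i j k) \<or> slices_le (\<lambda>k i j. p i j k)"
proof -
  note suff = mixture_product_if_slices_ge mixture_product_if_slices_le
  \<comment> \<open>A transposition of axes undoes itself, whereas the cyclic shift below takes two
    transpositions to undo.\<close>
  have "mixture_product p" if "mixture_product (\<lambda>j i k. p i j k)"
    using mixture_product_swap12[OF that] .
  moreover have "mixture_product p" if "mixture_product (\<lambda>k i j. p i j k)"
    using mixture_product_swap23[OF mixture_product_swap12[OF that]] .
  ultimately show ?thesis
    using mixture_product_slices suff[of p] suff[of "\<lambda>j i k. p i j k"] suff[of "\<lambda>k i j. p i j k"] assms
    by blast
qed

theorem theorem1:
  fixes p :: tensor3
  assumes "p \<in> simplex7"
    and "\<forall>i j k. p i j k > 0"
  shows "p \<in> RBM32 \<longleftrightarrow>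
    ((p False False False * p False True True \<ge> p False False True * p False True False \<and>
      p True False False * p True True True \<ge> p True False True * p True True False) \<or>
     (p False False False * p False True True \<le> p False False True * p False True False \<and>
      p True False False * p True True True \<le> p True False True * p True True False) \<or>
     (p False False False * p True False True \<ge> p False False True * p True False False \<and>
      p False True False * p True True True \<ge> p False True True * p True True False) \<or>
     (p False False False * p True False True \<le> p False False True * p True False False \<and>
      p False True False * p True True True \<le> p False True True * p True True False) \<or>
     (p False False False * p True True False \<ge> p True False False * p False True False \<and>
      p False False True * p True True True \<ge> p True False True * p False True True) \<or>
     (p False False False * p True True False \<le> p True False False * p False True False \<and>
      p False False True * p True True True \<le> p True False True * p False True True))"
proof -
  from assms(1) have "p \<in> RBM32 \<longleftrightarrow> mixture_product p"
    by (simp add: RBM32_iff)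
  also note mixture_product_iff_slices[of p, OF assms(2)[rule_format]]
  finally show ?thesis
    \<comment> \<open>Once the slice index is expanded, both sides differ only in the order of
      factors and conjuncts.\<close>
    unfolding slices_ge_def slices_le_def all_bool_eq by (simp only: mult.commute conj_commute)
qed

end
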